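(* Let $\mathcal{A}=\lambda/\mu$ be a skew diagram (with $\mu\subseteq\lambda$ partitions). Then $\Upsilon(\mathcal{A})=\mathcal{B}([\mathcal{A}])$, i.e. for every $i\ge 1$, \[\max\{\alpha_i \mid \alpha \text{ is a partition contained in } \mathcal{A}\}=\min\{\nu_i \mid c(\lambda;\mu,\nu)\neq 0\}.\]
   Context: Partitions are weakly decreasing sequences of nonnegative integers, identified with their Young diagrams (row $i$ has $\lambda_i$ left-justified boxes, matrix coordinates); $\alpha_i=0$ for $i>l(\alpha)$. For $\mu\subseteq\lambda$ the skew diagram $\lambda/\mu$ is the set of boxes of $\lambda$ not in $\mu$; $(\lambda/\mu)^\circ$ is its rotation by $180^\circ$. The Littlewood–Richardson coefficient $c(\lambda;\mu,\nu)$ is the number of semistandard fillings of $\lambda/\mu$ with content $\nu$ whose reverse row word (read right to left, top to bottom) is a lattice word. The skew character is $[\lambda/\mu]=\sum_\nu c(\lambda;\mu,\nu)[\nu]$, where $[\nu]$ are the irreducible characters of the symmetric group, and $[\nu]\in[\lambda/\mu]$ means $c(\lambda;\mu,\nu)\ne 0$. A partition $\alpha$ is contained in the skew diagram $\mathcal{A}$ if some subset of the boxes of $\mathcal{A}$ is a translate of the diagram of $\alpha$ or of the diagram $\alpha^\circ$ ($\alpha$ rotated by $180^\circ$). The union partition $\Upsilon(\mathcal{A})$ is defined by $\Upsilon(\mathcal{A})_i=\max(\alpha_i\mid \alpha\text{ contained in }\mathcal{A})$. For a character $\chi$, the base partition is $\mathcal{B}(\chi)_i=\min(\alpha_i\mid[\alpha]\in\chi)$.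 *)

theory Defs
  imports Main "HOL-Library.FuncSet" "HOL-Library.Product_Plus"
begin

text \<open>
  Rows, columns, parts and entries of fillings are all numbered from 0: the value \<open>\<alpha> i\<close>
  is the part usually written \<open>\<alpha>\<close> with index \<open>i + 1\<close>, and an entry \<open>k\<close> of a filling is the
  usual entry \<open>k + 1\<close>. A partition is extended by zeros to all of \<open>nat\<close>, so partitions
  differing only in trailing zeros are equal.
\<close>

definition is_partition :: "(nat \<Rightarrow> nat) \<Rightarrow> bool" where
  "is_partition \<alpha> \<longleftrightarrow> antimono \<alpha> \<and> finite {i. \<alpha> i \<noteq> 0}"

definition partition_length :: "(nat \<Rightarrow> nat) \<Rightarrow> nat" where
  "partition_length \<alpha> = card {i. \<alpha> i \<noteq> 0}"

text \<open>
  A box is a pair (row, column) in matrix coordinates. Integer coordinates make every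
  translation and the rotation by 180 degrees (up to translation, negation) available.
\<close>

type_synonym box = "int \<times> int"

definition diagram :: "(nat \<Rightarrow> nat) \<Rightarrow> box set" where
  "diagram \<alpha> = {(int i, int j) | i j. j < \<alpha> i}"

definition skew_diagram :: "(nat \<Rightarrow> nat) \<Rightarrow> (nat \<Rightarrow> nat) \<Rightarrow> box set" where
  "skew_diagram lam mu = diagram lam - diagram mu"

definition rotated :: "box set \<Rightarrow> box set" where
  "rotated D = uminus ` D"

definition is_translate :: "box set \<Rightarrow> box set \<Rightarrow> bool" where
  "is_translate S D \<longleftrightarrow> (\<exists>v. S = (\<lambda>b. v + b) ` D)"

definition contained_in :: "(nat \<Rightarrow> nat) \<Rightarrow> box set \<Rightarrow> bool" where
  "contained_in \<alpha> A \<longleftrightarrow>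
     (\<exists>S\<subseteq>A. is_translate S (diagram \<alpha>) \<or> is_translate S (rotated (diagram \<alpha>)))"

definition union_partition :: "box set \<Rightarrow> nat \<Rightarrow> nat" where
  "union_partition A i = Max {\<alpha> i | \<alpha>. is_partition \<alpha> \<and> contained_in \<alpha> A}"

text \<open>A filling is extensional, so that fillings are counted by their values on the diagram.\<close>

definition semistandard :: "box set \<Rightarrow> (box \<Rightarrow> nat) \<Rightarrow> bool" where
  "semistandard A T \<longleftrightarrow>
     T \<in> extensional A \<and>
     (\<forall>r c c'. (r, c) \<in> A \<and> (r, c') \<in> A \<and> c \<le> c' \<longrightarrow> T (r, c) \<le> T (r, c')) \<and>
     (\<forall>r r' c. (r, c) \<in> A \<and> (r', c) \<in> A \<and> r < r' \<longrightarrow> T (r, c) < T (r', c))"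

definition has_content :: "box set \<Rightarrow> (box \<Rightarrow> nat) \<Rightarrow> (nat \<Rightarrow> nat) \<Rightarrow> bool" where
  "has_content A T \<nu> \<longleftrightarrow> (\<forall>k. card {b \<in> A. T b = k} = \<nu> k)"

text \<open>Row \<open>i\<close> of the skew diagram consists of the columns \<open>mu i, \<dots>, lam i - 1\<close>.\<close>

definition reverse_row_word ::
    "(nat \<Rightarrow> nat) \<Rightarrow> (nat \<Rightarrow> nat) \<Rightarrow> (box \<Rightarrow> nat) \<Rightarrow> nat list" where
  "reverse_row_word lam mu T =
     concat (map (\<lambda>i. map (\<lambda>j. T (int i, int j)) (rev [mu i..<lam i]))
       [0..<partition_length lam])"

definition lattice_word :: "nat list \<Rightarrow> bool" where
  "lattice_word w \<longleftrightarrow> (\<forall>n k. count_list (take n w) (Suc k) \<le> count_list (take n w) k)"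

definition lr_coeff :: "(nat \<Rightarrow> nat) \<Rightarrow> (nat \<Rightarrow> nat) \<Rightarrow> (nat \<Rightarrow> nat) \<Rightarrow> nat" where
  "lr_coeff lam mu \<nu> =
     card {T. semistandard (skew_diagram lam mu) T \<and>
              has_content (skew_diagram lam mu) T \<nu> \<and>
              lattice_word (reverse_row_word lam mu T)}"

text \<open>
  The irreducible characters \<open>[\<nu>]\<close> are linearly independent, so a character is given by its
  multiplicities: \<open>\<chi> \<nu>\<close> is the coefficient of \<open>[\<nu>]\<close> in \<open>\<chi>\<close>, and
  \<open>[\<nu>] \<in> \<chi>\<close> means \<open>\<chi> \<nu> \<noteq> 0\<close>. Only the values at partitions matter.
\<close>

type_synonym multiplicities = "(nat \<Rightarrow> nat) \<Rightarrow> nat"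

definition skew_character :: "(nat \<Rightarrow> nat) \<Rightarrow> (nat \<Rightarrow> nat) \<Rightarrow> multiplicities" where
  "skew_character lam mu = (\<lambda>\<nu>. lr_coeff lam mu \<nu>)"

definition base_partition :: "multiplicities \<Rightarrow> nat \<Rightarrow> nat" where
  "base_partition \<chi> i = Min {\<alpha> i | \<alpha>. is_partition \<alpha> \<and> \<chi> \<alpha> \<noteq> 0}"

end

theory Submission imports Defs begin

text \<open>
  Both sides at \<open>i\<close> equal the largest width \<open>max\<^sub>r (\<lambda>\<^bsub>r+i\<^esub> - \<mu>\<^sub>r)\<close> of a rectangle with
  \<open>i + 1\<close> rows inside the skew diagram. For the union partition this is immediate.

  Let such a rectangle have width \<open>m\<close>. In a Littlewood--Richardson filling the columns increase
  strictly, so the \<open>m\<close> entries in its bottom row are at least \<open>i\<close>. A row is read in weakly decreasing order, so the lattice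
  condition, applied after reading the entries \<open>> j\<close> of that row for each \<open>j \<ge> i\<close>,
  telescopes to \<open>\<nu>\<^sub>i \<ge> m\<close>.

  Conversely, fill the top \<open>i\<close> boxes of every column with \<open>0, \<dots>, i - 1\<close>. The remaining boxes
  form right-justified row segments of lengths \<open>\<lambda>\<^sub>r - \<mu>\<^bsub>r-i\<^esub>\<close>; the box at distance \<open>p\<close>
  from the right end of its row receives \<open>i\<close> plus the number of earlier segments of length at
  least \<open>p\<close>. The resulting filling is a Littlewood--Richardson filling, and it contains at most
  one \<open>i\<close> for every \<open>p\<close>, hence no more than the longest segment has boxes.
\<close>

locale skew_shape =
  fixes lam mu :: "nat \<Rightarrow> nat"
  assumes lam: "is_partition lam" and mu: "is_partition mu"
begin

lemma lam_antimono: "r \<le> s \<Longrightarrow> lam s \<le> lam r"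
  using lam by (auto simp: is_partition_def antimono_def)

lemma mu_antimono: "r \<le> s \<Longrightarrow> mu s \<le> mu r"
  using mu by (auto simp: is_partition_def antimono_def)

section \<open>Skew diagrams in natural-number coordinates\<close>

definition boxes :: "(nat \<times> nat) set" where
  "boxes = {(r, c). mu r \<le> c \<and> c < lam r}"

definition embed :: "nat \<times> nat \<Rightarrow> box" where
  "embed = (\<lambda>(r, c). (int r, int c))"

lemma inj_embed: "inj embed"
  by (auto simp: inj_def embed_def)

lemma in_boxes [simp]: "(r, c) \<in> boxes \<longleftrightarrow> mu r \<le> c \<and> c < lam r"
  by (simp add: boxes_def)

lemma in_skew_diagram:
  "(x, y) \<in> skew_diagram lam mu \<longleftrightarrow>
     (\<exists>r c. x = int r \<and> y = int c \<and> mu r \<le> c \<and> c < lam r)"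
  by (auto simp: skew_diagram_def diagram_def not_less)

lemma skew_diagram_eq: "skew_diagram lam mu = embed ` boxes"
  by (auto simp: in_skew_diagram boxes_def embed_def image_iff)

lemma less_partition_length:
  assumes "0 < lam r"
  shows "r < partition_length lam"
proof -
  have "{..r} \<subseteq> {i. lam i \<noteq> 0}"
    using assms lam_antimono by force
  then have "card {..r} \<le> card {i. lam i \<noteq> 0}"
    using lam by (intro card_mono) (auto simp: is_partition_def)
  then show ?thesis
    by (simp add: partition_length_def)
qed

lemma finite_boxes: "finite boxes"
proof (rule finite_subset)
  show "boxes \<subseteq> {..<partition_length lam} \<times> {..<lam 0}"
  proof clarsimp
    fix r c assume "c < lam r"
    then show "r < partition_length lam \<and> c < lam 0"
      using less_partition_length[of r] lam_antimono[of 0 r] by linarith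
  qed
qed simp

lemma card_skew_diagram:
  "card {b \<in> skew_diagram lam mu. T b = k} = card {b \<in> boxes. T (embed b) = k}"
proof -
  have "{b \<in> skew_diagram lam mu. T b = k} = embed ` {b \<in> boxes. T (embed b) = k}"
    by (auto simp: skew_diagram_eq)
  then show ?thesis
    by (simp add: card_image inj_on_subset[OF inj_embed])
qed

lemma semistandard_iff:
  "semistandard (skew_diagram lam mu) T \<longleftrightarrow>
     T \<in> extensional (skew_diagram lam mu) \<and>
     (\<forall>r c c'. (r, c) \<in> boxes \<and> (r, c') \<in> boxes \<and> c \<le> c' \<longrightarrow>
        T (embed (r, c)) \<le> T (embed (r, c'))) \<and>
     (\<forall>r r' c. (r, c) \<in> boxes \<and> (r', c) \<in> boxes \<and> r < r' \<longrightarrow>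
        T (embed (r, c)) < T (embed (r', c)))"
  (is "_ \<longleftrightarrow> ?ext \<and> ?rows \<and> ?columns")
proof -
  let ?A = "skew_diagram lam mu"
  have box: "(int r, int c) \<in> ?A \<longleftrightarrow> (r, c) \<in> boxes" for r c
    by (simp add: in_skew_diagram)
  have "(\<forall>r c c'. (r, c) \<in> ?A \<and> (r, c') \<in> ?A \<and> c \<le> c' \<longrightarrow> T (r, c) \<le> T (r, c')) \<longleftrightarrow> ?rows"
    (is "?int_rows \<longleftrightarrow> _")
  proof
    show "?int_rows \<Longrightarrow> ?rows"
      unfolding embed_def prod.case box[symmetric] by (metis of_nat_le_iff)
    show "?rows \<Longrightarrow> ?int_rows"
      by (clarsimp simp: in_skew_diagram embed_def)
  qed
  moreover have
    "(\<forall>r r' c. (r, c) \<in> ?A \<and> (r', c) \<in> ?A \<and> r < r' \<longrightarrow> T (r, c) < T (r', c)) \<longleftrightarrow> ?columns"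
    (is "?int_columns \<longleftrightarrow> _")
  proof
    show "?int_columns \<Longrightarrow> ?columns"
      unfolding embed_def prod.case box[symmetric] by (metis of_nat_less_iff)
    show "?columns \<Longrightarrow> ?int_columns"
      by (clarsimp simp: in_skew_diagram embed_def)
  qed
  ultimately show ?thesis
    by (simp only: semistandard_def)
qed

section \<open>Prefixes of the reading word as sets of boxes\<close>

definition reading_before :: "nat \<times> nat \<Rightarrow> nat \<times> nat \<Rightarrow> bool" where
  "reading_before a b \<longleftrightarrow> fst a < fst b \<or> fst a = fst b \<and> snd b < snd a"

text \<open>Describes prefixes of the reading word as down-closed sets of boxes, so that the lattice
  condition can be tested on sets chosen by a property of their boxes.\<close>

definition initial :: "(nat \<times> nat) set \<Rightarrow> bool" where
  "initial P \<longleftrightarrow> P \<subseteq> boxes \<and> (\<forall>a\<in>boxes. \<forall>b\<in>P. reading_before a b \<longrightarrow> a \<in> P)"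

definition reading :: "(nat \<times> nat) list" where
  "reading = concat (map (\<lambda>r. map (Pair r) (rev [mu r..<lam r])) [0..<partition_length lam])"

lemma reverse_row_word_eq: "reverse_row_word lam mu T = map (T \<circ> embed) reading"
  by (simp add: reverse_row_word_def reading_def map_concat embed_def comp_def)

lemma set_reading: "set reading = boxes"
proof -
  have "r < partition_length lam" if "c < lam r" for r c
    using that by (intro less_partition_length) simp
  then show ?thesis
    by (force simp: reading_def boxes_def)
qed

lemma sorted_reading: "sorted_wrt reading_before reading"
proof -
  have row: "sorted_wrt reading_before (map (Pair r) (rev [a..<b]))" for r a b
    by (simp add: sorted_wrt_map sorted_wrt_rev reading_before_def)
  have "sorted_wrt reading_before
      (concat (map (\<lambda>r. map (Pair r) (rev [mu r..<lam r])) [0..<n]))" for n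
  proof (induction n)
    case (Suc n)
    then show ?case
      using row by (auto simp: sorted_wrt_append) (auto simp: reading_before_def)
  qed simp
  then show ?thesis
    by (simp add: reading_def)
qed

lemma distinct_reading: "distinct reading"
proof -
  have "sorted_wrt reading_before xs \<Longrightarrow> distinct xs" for xs
    by (induction xs) (auto simp: reading_before_def)
  then show ?thesis
    using sorted_reading by blast
qed

lemma count_list_take_reading:
  "count_list (take n (map f reading)) k = card {b \<in> set (take n reading). f b = k}"
proof -
  have "count_list (map f xs) k = length (filter (\<lambda>b. f b = k) xs)" for xs :: "(nat \<times> nat) list"
    by (induction xs) auto
  then have "count_list (take n (map f reading)) k =
      length (filter (\<lambda>b. f b = k) (take n reading))"
    by (simp add: take_map)
  also have "\<dots> = card (set (filter (\<lambda>b. f b = k) (take n reading)))"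
    by (rule distinct_card[symmetric]) (simp add: distinct_reading)
  finally show ?thesis
    by (simp only: set_filter)
qed

lemma initial_take: "initial (set (take n reading))"
  unfolding initial_def
proof (intro conjI ballI impI)
  show "set (take n reading) \<subseteq> boxes"
    using set_take_subset[of n reading] set_reading by simp
next
  fix a b
  assume a: "a \<in> boxes" and b: "b \<in> set (take n reading)" and ab: "reading_before a b"
  show "a \<in> set (take n reading)"
  proof (rule ccontr)
    assume "a \<notin> set (take n reading)"
    moreover have "a \<in> set (take n reading @ drop n reading)"
      using a set_reading by simp
    ultimately have "a \<in> set (drop n reading)"
      by (metis Un_iff set_append)
    moreover have "sorted_wrt reading_before (take n reading @ drop n reading)"
      using sorted_reading by simp
    ultimately have "reading_before b a"
      using b unfolding sorted_wrt_append by blast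
    then show False
      using ab by (auto simp: reading_before_def)
  qed
qed

lemma initial_imp_take:
  assumes "initial P"
  obtains n where "P = set (take n reading)"
proof -
  \<comment> \<open>The longest prefix inside \<open>P\<close>: the first box \<open>x\<close> after
    it lies outside \<open>P\<close> but would precede any further box of \<open>P\<close>, against
    down-closure.\<close>
  let ?t = "takeWhile (\<lambda>b. b \<in> P) reading" and ?d = "dropWhile (\<lambda>b. b \<in> P) reading"
  have "b \<in> set ?t" if b: "b \<in> P" for b
  proof (rule ccontr)
    assume "b \<notin> set ?t"
    moreover have "b \<in> set (?t @ ?d)"
      using b assms set_reading by (auto simp: initial_def)
    ultimately have "b \<in> set ?d"
      by (metis Un_iff set_append)
    moreover from this obtain x zs where d: "?d = x # zs"
      by (cases ?d) auto
    moreover have "x \<notin> P"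
      using d by (simp add: dropWhile_eq_Cons_conv)
    moreover have "sorted_wrt reading_before (?t @ ?d)"
      using sorted_reading by simp
    ultimately have "reading_before x b"
      using b by (auto simp del: takeWhile_dropWhile_id simp: sorted_wrt_append)
    moreover have "x \<in> boxes"
      using d set_reading set_dropWhileD[of x "\<lambda>b. b \<in> P" reading] by auto
    ultimately show False
      using assms b \<open>x \<notin> P\<close> by (auto simp: initial_def)
  qed
  then have "P = set ?t"
    by (auto dest: set_takeWhileD)
  then show ?thesis
    using that[of "length ?t"] by (metis takeWhile_eq_take)
qed

lemma lattice_word_iff:
  "lattice_word (reverse_row_word lam mu T) \<longleftrightarrow>
     (\<forall>P k. initial P \<longrightarrow> card {b \<in> P. T (embed b) = Suc k} \<le> card {b \<in> P. T (embed b) = k})"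
    (is "_ \<longleftrightarrow> (\<forall>P k. _ \<longrightarrow> ?le P k)")
proof -
  have "lattice_word (reverse_row_word lam mu T) \<longleftrightarrow> (\<forall>n k. ?le (set (take n reading)) k)"
    by (simp only: lattice_word_def reverse_row_word_eq count_list_take_reading comp_apply)
  also have "\<dots> \<longleftrightarrow> (\<forall>P k. initial P \<longrightarrow> ?le P k)"
  proof (intro iffI allI impI)
    fix P k
    assume le: "\<forall>n k. ?le (set (take n reading)) k" and "initial P"
    obtain n where "P = set (take n reading)"
      using \<open>initial P\<close> by (rule initial_imp_take)
    then show "?le P k"
      using le by blast
  next
    fix n k
    assume "\<forall>P k. initial P \<longrightarrow> ?le P k"
    then show "?le (set (take n reading)) k"
      using initial_take by blast
  qed
  finally show ?thesis .
qed

section \<open>Entries of a Littlewood--Richardson filling inside a rectangle\<close>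

text \<open>Rows \<open>r\<close> to \<open>r + i\<close> all meet column \<open>c\<close>, since
  \<open>mu\<close> and \<open>lam\<close> decrease; each step down raises the entry by at least
  one.\<close>

lemma entry_ge_depth:
  assumes ss: "semistandard (skew_diagram lam mu) T"
    and "mu r \<le> c" "c < lam (r + i)"
  shows "d \<le> i \<Longrightarrow> d \<le> T (embed (r + d, c))"
proof (induction d)
  case (Suc d)
  have box: "(r + e, c) \<in> boxes" if "e \<le> i" for e
    using assms(2,3) mu_antimono[of r "r + e"] lam_antimono[of "r + e" "r + i"] that by simp
  have "T (embed (r + d, c)) < T (embed (r + Suc d, c))"
    using ss box[of d] box[of "Suc d"] Suc.prems unfolding semistandard_iff
    by (metis Suc_leD add_Suc_right lessI)
  then show ?case
    using Suc by simp
qed simp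

lemma card_row_entries_le:
  assumes ss: "semistandard (skew_diagram lam mu) T"
    and lw: "lattice_word (reverse_row_word lam mu T)"
  shows "card {b \<in> boxes. fst b = R \<and> i \<le> T (embed b)} \<le> card {b \<in> boxes. T (embed b) = i}"
proof -
  define t where "t b = T (embed b)" for b
  define before at upto where "before j = card {b \<in> boxes. fst b < R \<and> t b = j}"
    and "at j = card {b \<in> boxes. fst b = R \<and> t b = j}"
    and "upto j = card {b \<in> boxes. fst b \<le> R \<and> t b = j}" for j
  have upto: "upto j = before j + at j" for j
  proof -
    have "{b \<in> boxes. fst b \<le> R \<and> t b = j} =
        {b \<in> boxes. fst b < R \<and> t b = j} \<union> {b \<in> boxes. fst b = R \<and> t b = j}"
      by auto
    then show ?thesis
      unfolding upto_def before_def at_def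
      by (simp add: card_Un_disjoint finite_boxes disjoint_iff)
  qed
  have step: "upto (Suc j) \<le> before j" for j
  proof -
    \<comment> \<open>Within row \<open>R\<close> the entries greater than \<open>j\<close> are read
      first. This prefix holds every \<open>Suc j\<close> up to row \<open>R\<close>, but only those
      \<open>j\<close> that lie above row \<open>R\<close>.\<close>
    define P where "P = {b \<in> boxes. fst b < R \<or> fst b = R \<and> j < t b}"
    have "initial P"
      unfolding initial_def
    proof (intro conjI ballI impI)
      fix a b
      assume a: "a \<in> boxes" and b: "b \<in> P" and ab: "reading_before a b"
      show "a \<in> P"
      proof (cases "fst b = R \<and> fst a = R")
        case True
        then obtain c d where cd: "a = (R, c)" "b = (R, d)" "d < c"
          using ab by (cases a, cases b) (auto simp: reading_before_def)
        moreover have "b \<in> boxes" "j < t b"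
          using b True by (auto simp: P_def)
        ultimately have "t b \<le> t a"
          using ss a unfolding semistandard_iff t_def by (metis less_imp_le)
        then show ?thesis
          using a cd \<open>j < t b\<close> by (simp add: P_def)
      next
        case False
        then show ?thesis
          using a b ab by (auto simp: P_def reading_before_def)
      qed
    qed (auto simp: P_def)
    then have "card {b \<in> P. t b = Suc j} \<le> card {b \<in> P. t b = j}"
      using lw by (auto simp: lattice_word_iff t_def)
    moreover have "{b \<in> P. t b = Suc j} = {b \<in> boxes. fst b \<le> R \<and> t b = Suc j}"
      and "{b \<in> P. t b = j} = {b \<in> boxes. fst b < R \<and> t b = j}"
      by (auto simp: P_def)
    ultimately show ?thesis
      by (simp add: upto_def before_def)
  qed
  \<comment> \<open>By \<open>step\<close>, \<open>before (i + d)\<close> makes room for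
    \<open>upto (Suc (i + d))\<close>, that is, for the entries \<open>Suc (i + d)\<close> of row
    \<open>R\<close> and the new remainder \<open>before (Suc (i + d))\<close>.\<close>
  have telescope: "card {b \<in> boxes. fst b = R \<and> i \<le> t b \<and> t b \<le> i + d} + before (i + d) \<le> upto i"
    for d
  proof (induction d)
    case 0
    have "{b \<in> boxes. fst b = R \<and> i \<le> t b \<and> t b \<le> i + 0} = {b \<in> boxes. fst b = R \<and> t b = i}"
      by auto
    then show ?case
      by (simp add: upto at_def)
  next
    case (Suc d)
    have "{b \<in> boxes. fst b = R \<and> i \<le> t b \<and> t b \<le> i + Suc d} =
        {b \<in> boxes. fst b = R \<and> i \<le> t b \<and> t b \<le> i + d} \<union>
        {b \<in> boxes. fst b = R \<and> t b = Suc (i + d)}"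
      by auto
    then have "card {b \<in> boxes. fst b = R \<and> i \<le> t b \<and> t b \<le> i + Suc d} =
        card {b \<in> boxes. fst b = R \<and> i \<le> t b \<and> t b \<le> i + d} + at (Suc (i + d))"
      unfolding at_def by (simp add: card_Un_disjoint finite_boxes disjoint_iff)
    then show ?case
      using Suc step[of "i + d"] upto[of "Suc (i + d)"] by simp
  qed
  \<comment> \<open>\<open>N\<close> bounds all entries, so the range up to \<open>i + N\<close> is
    no restriction; the inserted \<open>0\<close> keeps \<open>Max\<close> defined when there are no
    boxes.\<close>
  define N where "N = Max (insert 0 (t ` boxes))"
  have "{b \<in> boxes. fst b = R \<and> i \<le> t b} = {b \<in> boxes. fst b = R \<and> i \<le> t b \<and> t b \<le> i + N}"
    using Max_ge[of "insert 0 (t ` boxes)"] finite_boxes unfolding N_def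
    by (auto intro: trans_le_add2)
  then have "card {b \<in> boxes. fst b = R \<and> i \<le> t b} \<le> upto i"
    using telescope[of N] by simp
  also have "\<dots> \<le> card {b \<in> boxes. t b = i}"
    unfolding upto_def by (rule card_mono) (auto simp: finite_boxes)
  finally show ?thesis
    by (simp add: t_def)
qed

lemma rectangle_width_le_content:
  assumes ss: "semistandard (skew_diagram lam mu) T"
    and lw: "lattice_word (reverse_row_word lam mu T)"
    and content: "has_content (skew_diagram lam mu) T \<nu>"
  shows "lam (r + i) - mu r \<le> \<nu> i"
proof -
  let ?E = "{b \<in> boxes. fst b = r + i \<and> i \<le> T (embed b)}"
  have "Pair (r + i) ` {mu r..<lam (r + i)} \<subseteq> ?E"
    using entry_ge_depth[OF ss, of r _ i i] mu_antimono[of r "r + i"] by auto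
  then have "card (Pair (r + i) ` {mu r..<lam (r + i)}) \<le> card ?E"
    by (rule card_mono[rotated]) (simp add: finite_boxes)
  also have "\<dots> \<le> \<nu> i"
    using card_row_entries_le[OF ss lw] content
    by (simp add: has_content_def card_skew_diagram)
  finally show ?thesis
    by (simp add: card_image inj_on_def)
qed

section \<open>A filling with few entries \<open>i\<close>\<close>

text \<open>As \<open>mu\<close> and \<open>lam\<close> decrease, this is the row in which a
  nonempty column \<open>c\<close> of the diagram begins.\<close>

definition column_top :: "nat \<Rightarrow> nat" where
  "column_top c = (LEAST r. mu r \<le> c)"

lemma column_top_le_iff: "column_top c \<le> r \<longleftrightarrow> mu r \<le> c"
proof
  assume "mu r \<le> c"
  then show "column_top c \<le> r"
    unfolding column_top_def by (rule Least_le)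
next
  have "\<exists>r. mu r = 0"
    using mu ex_new_if_finite[of "{i. mu i \<noteq> 0}"] by (auto simp: is_partition_def)
  then have "mu (column_top c) \<le> c"
    unfolding column_top_def by (metis LeastI le0)
  moreover assume "column_top c \<le> r"
  ultimately show "mu r \<le> c"
    using mu_antimono le_trans by blast
qed

lemma column_top_antimono: "c \<le> d \<Longrightarrow> column_top d \<le> column_top c"
  by (metis column_top_le_iff le_refl le_trans)

text \<open>Removing the top \<open>i\<close> boxes of each column leaves in row \<open>s\<close>
  the columns from \<open>mu (s - i)\<close> to \<open>lam s - 1\<close> if
  \<open>i \<le> s\<close>, and nothing otherwise. Hence the bound on \<open>s\<close> and the
  length \<open>lam s - mu (s - i)\<close>.\<close>

definition earlier_segments :: "nat \<Rightarrow> nat \<Rightarrow> nat \<Rightarrow> nat set" where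
  "earlier_segments i r p = {s. i \<le> s \<and> s < r \<and> p \<le> lam s - mu (s - i)}"

text \<open>The value \<open>lam r - c\<close> is the distance from the right end of the row, with
  the last box at distance 1.\<close>

definition entry :: "nat \<Rightarrow> nat \<times> nat \<Rightarrow> nat" where
  "entry i = (\<lambda>(r, c). if r < column_top c + i then r - column_top c
     else i + card (earlier_segments i r (lam r - c)))"

lemma finite_earlier_segments [simp]: "finite (earlier_segments i r p)"
  by (simp add: earlier_segments_def)

lemma entry_upper:
  "r < column_top c + i \<Longrightarrow> entry i (r, c) = r - column_top c"
  by (simp add: entry_def)

lemma entry_lower:
  "column_top c + i \<le> r \<Longrightarrow> entry i (r, c) = i + card (earlier_segments i r (lam r - c))"
  by (simp add: entry_def)

lemma entry_ge_iff:
  assumes "(r, c) \<in> boxes"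
  shows "i \<le> entry i (r, c) \<longleftrightarrow> column_top c + i \<le> r"
  using assms by (auto simp: entry_def column_top_le_iff[symmetric])

lemma segment_length_ge:
  assumes "column_top c + i \<le> r"
  shows "lam r - c \<le> lam r - mu (r - i)"
proof -
  have "mu (r - i) \<le> c"
    using assms by (simp flip: column_top_le_iff)
  then show ?thesis
    by simp
qed

text \<open>Row \<open>r\<close> has a long enough segment and comes before \<open>r'\<close> but
  not before itself, so the set counted for \<open>r'\<close> is strictly larger.\<close>

lemma entry_lower_less:
  assumes "column_top c + i \<le> r" "column_top c' + i \<le> r'" "r < r'" "lam r' - c' \<le> lam r - c"
  shows "entry i (r, c) < entry i (r', c')"
proof -
  have "r \<in> earlier_segments i r' (lam r' - c')"
    using assms segment_length_ge[OF assms(1)] by (auto simp: earlier_segments_def)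
  moreover have "r \<notin> earlier_segments i r (lam r - c)"
    and "earlier_segments i r (lam r - c) \<subseteq> earlier_segments i r' (lam r' - c')"
    using assms by (auto simp: earlier_segments_def)
  ultimately have "earlier_segments i r (lam r - c) \<subset> earlier_segments i r' (lam r' - c')"
    by blast
  then show ?thesis
    using assms by (simp add: entry_lower psubset_card_mono)
qed

text \<open>Below the top \<open>i\<close> boxes of the columns, entries at one distance from the
  row end increase strictly downwards. This fixes the row, and the distance then fixes the
  column.\<close>

lemma entry_lower_inj:
  assumes "(r, c) \<in> boxes" "(r', c') \<in> boxes"
    and "column_top c + i \<le> r" "column_top c' + i \<le> r'"
    and "lam r - c = lam r' - c'" "entry i (r, c) = entry i (r', c')"
  shows "(r, c) = (r', c')"
proof -
  have "r = r'"
    using entry_lower_less[of c i r c' r'] entry_lower_less[of c' i r' c r] assms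
    by (metis less_irrefl nat_neq_iff order_refl)
  then show ?thesis
    using assms by auto
qed

text \<open>Moving right, column tops weakly rise and the distance to the row end shrinks, so the
  depth in the column and the set of counted segments can only grow.\<close>

lemma entry_row:
  assumes "(r, c) \<in> boxes" "(r, c') \<in> boxes" "c \<le> c'"
  shows "entry i (r, c) \<le> entry i (r, c')"
proof (cases "column_top c + i \<le> r")
  case True
  moreover have "earlier_segments i r (lam r - c) \<subseteq> earlier_segments i r (lam r - c')"
    using assms by (auto simp: earlier_segments_def)
  ultimately show ?thesis
    using column_top_antimono[OF assms(3)] by (simp add: entry_lower card_mono)
next
  case False
  then show ?thesis
    using column_top_antimono[OF assms(3)] assms
    by (auto simp: entry_def column_top_le_iff[symmetric])
qed

lemma entry_column:
  assumes "(r, c) \<in> boxes" "(r', c) \<in> boxes" "r < r'"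
  shows "entry i (r, c) < entry i (r', c)"
proof (cases "column_top c + i \<le> r")
  case True
  then show ?thesis
    using assms lam_antimono[of r r'] by (intro entry_lower_less) auto
next
  case False
  then show ?thesis
    using assms by (auto simp: entry_def column_top_le_iff[symmetric])
qed

text \<open>
  Every box with entry \<open>k + 1\<close> is matched with a box of an earlier row with entry \<open>k\<close>, in the same column if \<open>k < i\<close> and at the same distance from the end
  of the row otherwise.
\<close>

lemma entry_lattice:
  assumes P: "initial P"
  shows "card {b \<in> P. entry i b = Suc k} \<le> card {b \<in> P. entry i b = k}"
proof -
  have finP: "finite P"
    using P finite_boxes by (auto simp: initial_def intro: finite_subset)
  have box: "(r, c) \<in> boxes" if "(r, c) \<in> P" for r c
    using that P by (auto simp: initial_def)
  have earlier: "(s, d) \<in> P" if "(r, c) \<in> P" "(s, d) \<in> boxes" "s < r" for r c s d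
    using that P unfolding initial_def reading_before_def by fastforce
  show ?thesis
  proof (cases "k < i")
    case True
    \<comment> \<open>The box \<open>k\<close> rows below the top of the same column; as
      \<open>k < i\<close>, it is among the top \<open>i\<close> boxes and has entry
      \<open>k\<close>.\<close>
    let ?f = "\<lambda>(r::nat, c). (column_top c + k, c)"
    have "inj_on ?f {b \<in> P. entry i b = Suc k}"
    proof (rule inj_onI, clarsimp)
      fix r c r'
      assume "(r, c) \<in> P" "(r', c) \<in> P" "entry i (r, c) = Suc k" "entry i (r', c) = Suc k"
      then show "r = r'"
        using entry_column[of r c r' i] entry_column[of r' c r i] box
        by (metis less_irrefl nat_neq_iff)
    qed
    moreover have "?f ` {b \<in> P. entry i b = Suc k} \<subseteq> {b \<in> P. entry i b = k}"
    proof clarsimp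
      fix r c
      assume rc: "(r, c) \<in> P" and e: "entry i (r, c) = Suc k"
      have less: "column_top c + k < r"
      proof (cases "column_top c + i \<le> r")
        case False
        then show ?thesis
          using e by (simp add: entry_upper)
      qed (use True in simp)
      have "mu (column_top c + k) \<le> c"
        by (simp flip: column_top_le_iff)
      then have "(column_top c + k, c) \<in> boxes"
        using lam_antimono[of "column_top c + k" r] less box[OF rc] by simp
      then show "(column_top c + k, c) \<in> P \<and> entry i (column_top c + k, c) = k"
        using earlier[OF rc] less True by (simp add: entry_upper)
    qed
    ultimately show ?thesis
      using finP by (intro card_inj_on_le) auto
  next
    case False
    let ?S = "\<lambda>(r, c). earlier_segments i r (lam r - c)"
    \<comment> \<open>The partner lies in the last of the segments counted for
      \<open>(r, c)\<close>, at the same distance from the row end.\<close>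
    let ?f = "\<lambda>(r, c). let s = Max (?S (r, c)) in (s, lam s - (lam r - c))"
    have lower: "column_top c + i \<le> r" if "(r, c) \<in> P" "entry i (r, c) = Suc k" for r c
      using that False entry_ge_iff[OF box, of r c i] by simp
    have match: "\<exists>s d. ?f (r, c) = (s, d) \<and> (s, d) \<in> P \<and> entry i (s, d) = k \<and> lam s - d = lam r - c"
      if rc: "(r, c) \<in> P" and e: "entry i (r, c) = Suc k" for r c
    proof -
      define p where "p = lam r - c"
      define s where "s = Max (earlier_segments i r p)"
      have p: "0 < p"
        using box[OF rc] by (simp add: p_def)
      have cS: "i + card (earlier_segments i r p) = Suc k"
        using e lower[OF rc e] by (simp add: entry_lower p_def)
      then have "earlier_segments i r p \<noteq> {}"
        using False by auto
      then have sS: "s \<in> earlier_segments i r p"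
        unfolding s_def by (intro Max_in) auto
      then have s: "i \<le> s" "s < r" "p \<le> lam s - mu (s - i)"
        by (auto simp: earlier_segments_def)
      define d where "d = lam s - p"
      have d: "mu (s - i) \<le> d" "d < lam s" "lam s - d = p"
        using s p by (auto simp: d_def)
      have "(s, d) \<in> boxes"
        using d mu_antimono[of "s - i" s] by simp
      moreover have "column_top d + i \<le> s"
        using d(1) s(1) by (simp flip: column_top_le_iff)
      \<comment> \<open>As \<open>s\<close> is the maximum, the segments counted at \<open>s\<close>
        are those counted at \<open>r\<close> except \<open>s\<close> itself, so the entry drops by
        exactly one.\<close>
      moreover have "earlier_segments i s p = earlier_segments i r p - {s}"
      proof
        show "earlier_segments i s p \<subseteq> earlier_segments i r p - {s}"
          using s by (auto simp: earlier_segments_def)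
        have "x \<le> s" if "x \<in> earlier_segments i r p" for x
          using that unfolding s_def by simp
        then show "earlier_segments i r p - {s} \<subseteq> earlier_segments i s p"
          by (force simp: earlier_segments_def)
      qed
      ultimately have "entry i (s, d) = k"
        using cS sS False by (simp add: entry_lower d(3))
      then show ?thesis
        using earlier[OF rc \<open>(s, d) \<in> boxes\<close> s(2)] d(3)
        by (auto simp: Let_def s_def d_def p_def)
    qed
    \<comment> \<open>The map keeps the distance from the row end, so two preimages of one box agree
      in distance and entry, and \<open>entry_lower_inj\<close> identifies them.\<close>
    have "inj_on ?f {b \<in> P. entry i b = Suc k}"
    proof (rule inj_onI)
      fix a b
      assume ab: "a \<in> {b \<in> P. entry i b = Suc k}" "b \<in> {b \<in> P. entry i b = Suc k}"
        and f: "?f a = ?f b"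
      obtain r c r' c' where eq: "a = (r, c)" "b = (r', c')"
        by fastforce
      have rc: "(r, c) \<in> P" "entry i (r, c) = Suc k" "(r', c') \<in> P" "entry i (r', c') = Suc k"
        using ab eq by auto
      obtain s d where "?f a = (s, d)" "lam s - d = lam r - c"
        using match[OF rc(1,2)] unfolding eq by blast
      moreover obtain s' d' where "?f b = (s', d')" "lam s' - d' = lam r' - c'"
        using match[OF rc(3,4)] unfolding eq by blast
      ultimately have "lam r - c = lam r' - c'"
        using f by simp
      then show "a = b"
        unfolding eq using rc by (intro entry_lower_inj[where i = i] box lower) auto
    qed
    moreover have "?f ` {b \<in> P. entry i b = Suc k} \<subseteq> {b \<in> P. entry i b = k}"
      using match by fastforce
    ultimately show ?thesis
      using finP by (intro card_inj_on_le) auto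
  qed
qed

lemma card_entry_le:
  assumes M: "\<And>r. lam (r + i) - mu r \<le> M"
  shows "card {b \<in> boxes. entry i b = i} \<le> M"
proof -
  let ?f = "\<lambda>(r, c). lam r - c"
  have lower: "column_top c + i \<le> r" if "(r, c) \<in> boxes" "entry i (r, c) = i" for r c
    using that entry_ge_iff[of r c i] by simp
  have "inj_on ?f {b \<in> boxes. entry i b = i}"
  proof (rule inj_onI)
    fix a b
    assume "a \<in> {b \<in> boxes. entry i b = i}" "b \<in> {b \<in> boxes. entry i b = i}" "?f a = ?f b"
    then show "a = b"
      using lower entry_lower_inj[of "fst a" "snd a" "fst b" "snd b" i]
      by (cases a, cases b) (simp del: in_boxes)
  qed
  moreover have "?f ` {b \<in> boxes. entry i b = i} \<subseteq> {1..M}"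
  proof (clarify)
    fix r c
    assume rc: "(r, c) \<in> boxes" "entry i (r, c) = i"
    \<comment> \<open>The segment of row \<open>r\<close> is the bottom row of a rectangle with top
      row \<open>r - i\<close>, so the bound \<open>M\<close> applies to its length.\<close>
    have "lam r - c \<le> lam (r - i + i) - mu (r - i)"
      using segment_length_ge[OF lower[OF rc]] lower[OF rc] by simp
    then show "lam r - c \<in> {1..M}"
      using M[of "r - i"] rc(1) by (auto simp: Suc_le_eq)
  qed
  ultimately show ?thesis
    using card_inj_on_le[of ?f _ "{1..M}"] by simp
qed

lemma lr_coeff_nonzero_iff:
  assumes "is_partition \<nu>"
  shows "lr_coeff lam mu \<nu> \<noteq> 0 \<longleftrightarrow>
    (\<exists>T. semistandard (skew_diagram lam mu) T \<and> has_content (skew_diagram lam mu) T \<nu> \<and>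
      lattice_word (reverse_row_word lam mu T))" (is "_ \<longleftrightarrow> (\<exists>T. ?LR T)")
proof -
  let ?A = "skew_diagram lam mu"
  have finA: "finite ?A"
    by (simp add: skew_diagram_eq finite_boxes)
  \<comment> \<open>\<open>card\<close> is 0 on infinite sets, so finiteness is needed; the finite
    support of \<open>\<nu>\<close> leaves finitely many values for each box.\<close>
  have "{T. ?LR T} \<subseteq> PiE ?A (\<lambda>_. {k. \<nu> k \<noteq> 0})"
  proof
    fix T assume T: "T \<in> {T. ?LR T}"
    have "\<nu> (T b) \<noteq> 0" if b: "b \<in> ?A" for b
    proof -
      have "b \<in> {b' \<in> ?A. T b' = T b}"
        using b by simp
      moreover have "finite {b' \<in> ?A. T b' = T b}"
        by (rule finite_subset[OF _ finA]) blast
      ultimately have "0 < card {b' \<in> ?A. T b' = T b}"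
        unfolding card_gt_0_iff by blast
      then show ?thesis
        using T by (simp add: has_content_def)
    qed
    then show "T \<in> PiE ?A (\<lambda>_. {k. \<nu> k \<noteq> 0})"
      using T by (auto simp: PiE_def semistandard_def)
  qed
  moreover have "finite (PiE ?A (\<lambda>_. {k. \<nu> k \<noteq> 0}))"
    using assms finA by (intro finite_PiE) (auto simp: is_partition_def)
  ultimately have "finite {T. ?LR T}"
    by (rule finite_subset)
  then show ?thesis
    by (auto simp: lr_coeff_def)
qed

lemma exists_constituent_with_small_part:
  assumes M: "\<And>r. lam (r + i) - mu r \<le> M"
  shows "\<exists>\<nu>. is_partition \<nu> \<and> lr_coeff lam mu \<nu> \<noteq> 0 \<and> \<nu> i \<le> M"
proof -
  define T where "T = restrict (entry i \<circ> inv embed) (skew_diagram lam mu)"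
  have T: "T (embed b) = entry i b" if "b \<in> boxes" for b
    using that by (simp add: T_def skew_diagram_eq inv_f_f inj_embed)
  define \<nu> where "\<nu> k = card {b \<in> boxes. entry i b = k}" for k
  have "{b \<in> P. T (embed b) = k} = {b \<in> P. entry i b = k}" if "P \<subseteq> boxes" for P k
    using that T by auto
  then have "lattice_word (reverse_row_word lam mu T)"
    using entry_lattice by (simp add: lattice_word_iff initial_def)
  moreover have "semistandard (skew_diagram lam mu) T"
    unfolding semistandard_iff using entry_row entry_column T by (auto simp: T_def simp del: in_boxes)
  moreover have "has_content (skew_diagram lam mu) T \<nu>"
    using T by (auto simp: has_content_def card_skew_diagram \<nu>_def intro!: arg_cong[where f = card])
  moreover have "is_partition \<nu>"
    unfolding is_partition_def
  proof
    \<comment> \<open>The set \<open>boxes\<close> is itself initial, so the lattice condition for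
      the whole word says that the content decreases.\<close>
    show "antimono \<nu>"
      using entry_lattice[of boxes i]
      by (auto simp: antimono_iff_le_Suc \<nu>_def initial_def)
    have "{k. \<nu> k \<noteq> 0} \<subseteq> entry i ` boxes"
      by (auto simp: \<nu>_def finite_boxes)
    then show "finite {k. \<nu> k \<noteq> 0}"
      by (rule finite_subset) (simp add: finite_boxes)
  qed
  ultimately have "lr_coeff lam mu \<nu> \<noteq> 0"
    using lr_coeff_nonzero_iff[of \<nu>] by blast
  then show ?thesis
    using \<open>is_partition \<nu>\<close> card_entry_le[OF M] by (auto simp: \<nu>_def)
qed

section \<open>The largest rectangle with a given number of rows\<close>

text \<open>Rows \<open>r\<close> to \<open>r + i\<close> have exactly the columns from
  \<open>mu r\<close> to \<open>lam (r + i) - 1\<close> in common; truncated subtraction gives 0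
  when there are none.\<close>

definition rectangle_width :: "nat \<Rightarrow> nat" where
  "rectangle_width i = Max (range (\<lambda>r. lam (r + i) - mu r))"

lemma finite_widths: "finite (range (\<lambda>r. lam (r + i) - mu r))"
proof (rule finite_subset)
  show "range (\<lambda>r. lam (r + i) - mu r) \<subseteq> {..lam 0}"
    using lam_antimono[of 0] by (auto intro: le_trans[OF diff_le_self])
qed simp

lemma rectangle_width_ge: "lam (r + i) - mu r \<le> rectangle_width i"
  unfolding rectangle_width_def by (rule Max_ge[OF finite_widths]) simp

lemma rectangle_width_attained:
  obtains r where "rectangle_width i = lam (r + i) - mu r"
proof -
  have "rectangle_width i \<in> range (\<lambda>r. lam (r + i) - mu r)"
    unfolding rectangle_width_def by (rule Max_in[OF finite_widths]) simp
  then show ?thesis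
    using that by blast
qed

lemma base_partition_eq: "base_partition (skew_character lam mu) i = rectangle_width i"
proof -
  let ?V = "{\<alpha> i | \<alpha>. is_partition \<alpha> \<and> lr_coeff lam mu \<alpha> \<noteq> 0}"
  \<comment> \<open>\<open>Min\<close> needs a finite set: every part counts some of the boxes, so
    it is at most their number.\<close>
  have "?V \<subseteq> {..card boxes}"
  proof
    fix v assume "v \<in> ?V"
    then obtain \<nu> where "v = \<nu> i" "is_partition \<nu>" "lr_coeff lam mu \<nu> \<noteq> 0"
      by blast
    moreover from this obtain T where "has_content (skew_diagram lam mu) T \<nu>"
      using lr_coeff_nonzero_iff by blast
    ultimately have "v = card {b \<in> boxes. T (embed b) = i}"
      by (simp add: has_content_def card_skew_diagram)
    then show "v \<in> {..card boxes}"
      by (simp add: card_mono finite_boxes)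
  qed
  then have fin: "finite ?V"
    by (rule finite_subset) simp
  have ge: "rectangle_width i \<le> v" if "v \<in> ?V" for v
  proof -
    obtain \<nu> where \<nu>: "v = \<nu> i" "is_partition \<nu>" "lr_coeff lam mu \<nu> \<noteq> 0"
      using \<open>v \<in> ?V\<close> by blast
    obtain r where r: "rectangle_width i = lam (r + i) - mu r"
      by (rule rectangle_width_attained)
    show ?thesis
      using \<nu>(3) rectangle_width_le_content
      unfolding \<nu>(1) r lr_coeff_nonzero_iff[OF \<nu>(2)] by blast
  qed
  obtain \<nu> where \<nu>: "is_partition \<nu>" "lr_coeff lam mu \<nu> \<noteq> 0" "\<nu> i \<le> rectangle_width i"
    using exists_constituent_with_small_part[OF rectangle_width_ge] by blast
  then have "\<nu> i = rectangle_width i"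
    using ge by (auto intro!: antisym)
  then have "rectangle_width i \<in> ?V"
    using \<nu>(1,2) by (metis (mono_tags, lifting) mem_Collect_eq)
  then show ?thesis
    unfolding base_partition_def skew_character_def using fin ge by (intro Min_eqI) auto
qed

text \<open>Only two boxes matter: the first of row 0 and the last of row \<open>i\<close>. Their
  images in the skew diagram are opposite corners of a rectangle with \<open>i + 1\<close> rows and
  width \<open>\<alpha> i\<close>.\<close>

lemma contained_in_rectangle_width:
  assumes \<alpha>: "is_partition \<alpha>" and "contained_in \<alpha> (skew_diagram lam mu)"
  shows "\<alpha> i \<le> rectangle_width i"
proof (cases "\<alpha> i = 0")
  case False
  have "\<alpha> i \<le> \<alpha> 0"
    using \<alpha> by (auto simp: is_partition_def antimono_def)
  then have corners: "(0, 0) \<in> diagram \<alpha>" "(int i, int (\<alpha> i - 1)) \<in> diagram \<alpha>"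
    using False by (auto simp: diagram_def intro!: exI[of _ "\<alpha> i - 1"])
  obtain S where S: "S \<subseteq> skew_diagram lam mu"
    and "is_translate S (diagram \<alpha>) \<or> is_translate S (rotated (diagram \<alpha>))"
    using assms by (auto simp: contained_in_def)
  then obtain x y where
    "(\<lambda>b. (x, y) + b) ` diagram \<alpha> \<subseteq> skew_diagram lam mu \<or>
     (\<lambda>b. (x, y) + b) ` uminus ` diagram \<alpha> \<subseteq> skew_diagram lam mu"
    unfolding is_translate_def rotated_def by (metis surj_pair)
  then have "((x, y) + (0, 0) \<in> skew_diagram lam mu \<and>
        (x, y) + (int i, int (\<alpha> i - 1)) \<in> skew_diagram lam mu) \<or>
      ((x, y) + - (0, 0) \<in> skew_diagram lam mu \<and>
        (x, y) + - (int i, int (\<alpha> i - 1)) \<in> skew_diagram lam mu)"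
    using corners by blast
  then obtain r c where "(int r, int c) \<in> skew_diagram lam mu"
    "(int (r + i), int (c + (\<alpha> i - 1))) \<in> skew_diagram lam mu"
  proof (elim disjE conjE)
    assume *: "(x, y) + (0, 0) \<in> skew_diagram lam mu"
      "(x, y) + (int i, int (\<alpha> i - 1)) \<in> skew_diagram lam mu"
    then obtain r c where "x = int r" "y = int c"
      by (auto simp: in_skew_diagram)
    then show ?thesis
      using * that[of r c] by simp
  next
    assume *: "(x, y) + - (0, 0) \<in> skew_diagram lam mu"
      "(x, y) + - (int i, int (\<alpha> i - 1)) \<in> skew_diagram lam mu"
    \<comment> \<open>After rotation the two corners change places, so the image of the last box of
      row \<open>i\<close> gives \<open>(r, c)\<close>.\<close>
    then obtain r c where "x - int i = int r" "y - int (\<alpha> i - 1) = int c"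
      by (auto simp: in_skew_diagram)
    then have "x = int (r + i)" "y = int (c + (\<alpha> i - 1))"
      by simp_all
    then show ?thesis
      using * that[of r c] by simp
  qed
  then have "mu r \<le> c" "c + (\<alpha> i - 1) < lam (r + i)"
    by (simp_all add: in_skew_diagram del: of_nat_add)
  then have "\<alpha> i \<le> lam (r + i) - mu r"
    by simp
  then show ?thesis
    using rectangle_width_ge le_trans by blast
qed simp

lemma union_partition_eq: "union_partition (skew_diagram lam mu) i = rectangle_width i"
proof -
  let ?V = "{\<alpha> i | \<alpha>. is_partition \<alpha> \<and> contained_in \<alpha> (skew_diagram lam mu)}"
  have le: "v \<le> rectangle_width i" if "v \<in> ?V" for v
    using that contained_in_rectangle_width by auto
  then have fin: "finite ?V"
    by (meson finite_nat_set_iff_bounded_le)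
  obtain r where r: "rectangle_width i = lam (r + i) - mu r"
    by (rule rectangle_width_attained)
  \<comment> \<open>The rectangle itself as a partition, with \<open>i + 1\<close> rows of maximal
    width; its top left corner is placed at \<open>(r, mu r)\<close>.\<close>
  define \<alpha> where "\<alpha> j = (if j \<le> i then rectangle_width i else 0)" for j
  have "is_partition \<alpha>"
    unfolding is_partition_def
  proof
    show "antimono \<alpha>"
      by (auto simp: antimono_def \<alpha>_def)
    show "finite {j. \<alpha> j \<noteq> 0}"
      by (rule finite_subset[of _ "{..i}"]) (auto simp: \<alpha>_def)
  qed
  moreover have "(\<lambda>b. (int r, int (mu r)) + b) ` diagram \<alpha> \<subseteq> skew_diagram lam mu"
  proof (clarsimp simp: diagram_def)
    fix s c
    assume c: "c < \<alpha> s"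
    then have s: "s \<le> i"
      by (auto simp: \<alpha>_def split: if_splits)
    then have "mu (r + s) \<le> mu r + c" "mu r + c < lam (r + s)"
      using c r lam_antimono[of "r + s" "r + i"] mu_antimono[of r "r + s"] by (auto simp: \<alpha>_def)
    then show "(int r + int s, int (mu r) + int c) \<in> skew_diagram lam mu"
      unfolding in_skew_diagram by (metis of_nat_add)
  qed
  then have "contained_in \<alpha> (skew_diagram lam mu)"
    by (auto simp: contained_in_def is_translate_def)
  moreover have "\<alpha> i = rectangle_width i"
    by (simp add: \<alpha>_def)
  ultimately have "rectangle_width i \<in> ?V"
    by (metis (mono_tags, lifting) mem_Collect_eq)
  then show ?thesis
    unfolding union_partition_def using fin le by (intro Max_eqI) auto
qed

end

theorem theorem3p4:
  fixes lam mu :: "nat \<Rightarrow> nat"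
  assumes "is_partition lam" and "is_partition mu" and "diagram mu \<subseteq> diagram lam"
  shows "union_partition (skew_diagram lam mu) = base_partition (skew_character lam mu)"
proof -
  interpret skew_shape lam mu
    using assms by unfold_locales
  show ?thesis
    by (rule ext) (simp add: union_partition_eq base_partition_eq)
qed

end
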